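(* Let $A \in E_{N-1}$, i.e. $A \in \mathrm{M}(m\times m,\mathbb{R})$ with $\nu_{k+1} = A\nu_k$ for all $k \in \{0,\dots,N-1\}$. Then, with $\Sigma_t = \mathrm{var}(R_t)$, $\Omega_t = \mathrm{var}(D_t)$ and $\Gamma_t = \mathbb{E}(R_t D_t^\top)$, $$\Sigma_{t+1} = A \Sigma_t A^\top + A \Gamma_t + \Gamma_t^\top A^\top + \Omega_t$$ for each $t \in \{1,\dots,N-1\}$.
   Context: Setting: $f \colon \mathbb{R}^n \to \mathbb{R}^n$ is continuous, and $X \subset \mathbb{R}^n$ is non-empty, compact and forward invariant ($x \in X$ implies $f(x) \in X$). For $\bar{x} \in X$, $x(\cdot,\bar{x}) \colon \mathbb{N}_0 \to X$ denotes the trajectory $x(0,\bar x) = \bar x$, $x(t+1,\bar x) = f(x(t,\bar x))$. The functions $\psi_1,\dots,\psi_m \in L^2(X,\mathbb{R})$ are continuous and linearly independent, and the lift $\Psi \colon X \to \mathbb{R}^m$, $\Psi(x) = (\psi_1(x),\dots,\psi_m(x))^\top$, is assumed injective. Fixed sample points $x_1,\dots,x_L \in X$ with $L \ge m$ and a fixed horizon $N \in \mathbb{N}$ ($N \geq 1$) are given, and the $m \times L$ matrix $G_0 = (\Psi(x_1)\ \cdots\ \Psi(x_L))$ is assumed to have full row rank. $\mathrm{M}(m\times m,\mathbb{R})$ is the space of real $m \times m$ matrices. For $A \in \mathrm{M}(m\times m,\mathbb{R})$, $z(\cdot,\bar x)\colon \mathbb{N}_0 \to \mathbb{R}^m$ is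 defined by $z(0,\bar x) = \Psi(\bar x)$, $z(t+1,\bar x) = A z(t,\bar x)$. Expectations are taken with respect to the empirical probability measure $P_L = \frac1L \sum_{i=1}^L \delta_{x_i}$ on the Borel sets of $X$ ($\delta_{x_i}$ the Dirac measure at $x_i$), i.e. $\mathbb{E}(Y) = \frac1L\sum_{i=1}^L Y(x_i)$; the variance is $\mathrm{var}(Y) = \mathbb{E}((Y-\mathbb{E}(Y))(Y-\mathbb{E}(Y))^\top)$. Multi-step residual: $R_t \colon X \to \mathbb{R}^m$, $R_t(\bar x) = \Psi(x(t,\bar x)) - z(t,\bar x)$ for $t \in \{1,\dots,N\}$. Local error: $D_t \colon X \to \mathbb{R}^m$, $D_t(\bar x) = \Psi(x(t+1,\bar x)) - A\Psi(x(t,\bar x))$ for $t \in \{0,\dots,N-1\}$. Arithmetic means: $\nu_t = \frac1L\sum_{i=1}^L \Psi(x(t,x_i))$ for $t \in \{0,\dots,N\}$. *)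

theory Defs
  imports "HOL-Probability.Probability"
begin

primrec trajectory :: "('a \<Rightarrow> 'a) \<Rightarrow> 'a \<Rightarrow> nat \<Rightarrow> 'a" where
  "trajectory f x 0 = x"
| "trajectory f x (Suc t) = f (trajectory f x t)"

definition lift :: "('m::finite \<Rightarrow> 'a \<Rightarrow> real) \<Rightarrow> 'a \<Rightarrow> real ^ 'm" where
  "lift \<psi> x = (\<chi> i. \<psi> i x)"

primrec lifted_trajectory ::
    "('m::finite \<Rightarrow> 'a \<Rightarrow> real) \<Rightarrow> real ^ 'm ^ 'm \<Rightarrow> 'a \<Rightarrow> nat \<Rightarrow> real ^ 'm" where
  "lifted_trajectory \<psi> A x 0 = lift \<psi> x"
| "lifted_trajectory \<psi> A x (Suc t) = A *v lifted_trajectory \<psi> A x t"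

text \<open>Square integrability refers to Lebesgue measure on the Borel set \<open>X\<close>.\<close>

definition square_integrable_on :: "('a::euclidean_space \<Rightarrow> real) \<Rightarrow> 'a set \<Rightarrow> bool" where
  "square_integrable_on g X \<longleftrightarrow>
     set_borel_measurable lborel X g \<and> set_integrable lborel X (\<lambda>x. (g x)\<^sup>2)"

text \<open>
  Independence is that of the functions on \<open>X\<close>. It is implied by independence of the
  almost-everywhere classes in \<open>L\<^sup>2\<close>, so as a hypothesis it is the less restrictive of the two.
\<close>

definition lin_indep_functions_on :: "'a set \<Rightarrow> ('m::finite \<Rightarrow> 'a \<Rightarrow> real) \<Rightarrow> bool" where
  "lin_indep_functions_on X \<psi> \<longleftrightarrow>
     (\<forall>c. (\<forall>x\<in>X. (\<Sum>i\<in>UNIV. c i * \<psi> i x) = 0) \<longrightarrow> (\<forall>i. c i = 0))"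

text \<open>
  The sample points are a family indexed by a finite type \<open>'l\<close> with \<open>L = CARD('l)\<close>;
  repetitions are allowed and counted with multiplicity.
\<close>

definition data_matrix ::
    "('m::finite \<Rightarrow> 'a \<Rightarrow> real) \<Rightarrow> ('l::finite \<Rightarrow> 'a) \<Rightarrow> real ^ 'l ^ 'm" where
  "data_matrix \<psi> p = (\<chi> i j. lift \<psi> (p j) $ i)"

text \<open>\<open>1/L\<close> times the sum of the Dirac measures at the sample points, on the Borel sets of \<open>X\<close>.\<close>

definition empirical_measure ::
    "'a::topological_space set \<Rightarrow> ('l::finite \<Rightarrow> 'a) \<Rightarrow> 'a measure" where
  "empirical_measure X p =
     measure_of X (sets (restrict_space borel X))
       (\<lambda>B. (\<Sum>i\<in>UNIV. emeasure (return (restrict_space borel X) (p i)) B) / of_nat CARD('l))"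

definition outer_product :: "real ^ 'm \<Rightarrow> real ^ 'k \<Rightarrow> real ^ 'k ^ 'm" where
  "outer_product v w = (\<chi> i j. v $ i * w $ j)"

definition variance_matrix ::
    "'a measure \<Rightarrow> ('a \<Rightarrow> real ^ 'm::finite) \<Rightarrow> real ^ 'm ^ 'm" where
  "variance_matrix M Y =
     (LINT x|M. outer_product (Y x - (LINT y|M. Y y)) (Y x - (LINT y|M. Y y)))"

definition residual ::
    "('a \<Rightarrow> 'a) \<Rightarrow> ('m::finite \<Rightarrow> 'a \<Rightarrow> real) \<Rightarrow> real ^ 'm ^ 'm \<Rightarrow> nat \<Rightarrow> 'a \<Rightarrow> real ^ 'm" where
  "residual f \<psi> A t x = lift \<psi> (trajectory f x t) - lifted_trajectory \<psi> A x t"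

definition local_error ::
    "('a \<Rightarrow> 'a) \<Rightarrow> ('m::finite \<Rightarrow> 'a \<Rightarrow> real) \<Rightarrow> real ^ 'm ^ 'm \<Rightarrow> nat \<Rightarrow> 'a \<Rightarrow> real ^ 'm" where
  "local_error f \<psi> A t x =
     lift \<psi> (trajectory f x (t + 1)) - A *v lift \<psi> (trajectory f x t)"

definition sample_mean ::
    "('a \<Rightarrow> 'a) \<Rightarrow> ('m::finite \<Rightarrow> 'a \<Rightarrow> real) \<Rightarrow> ('l::finite \<Rightarrow> 'a) \<Rightarrow> nat \<Rightarrow> real ^ 'm" where
  "sample_mean f \<psi> p t =
     (1 / real CARD('l)) *\<^sub>R (\<Sum>i\<in>UNIV. lift \<psi> (trajectory f (p i) t))"

definition mean_exact_matrices ::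
    "('a \<Rightarrow> 'a) \<Rightarrow> ('m::finite \<Rightarrow> 'a \<Rightarrow> real) \<Rightarrow> ('l::finite \<Rightarrow> 'a) \<Rightarrow> nat \<Rightarrow> (real ^ 'm ^ 'm) set" where
  "mean_exact_matrices f \<psi> p K =
     {A. \<forall>k\<le>K. sample_mean f \<psi> p (k + 1) = A *v sample_mean f \<psi> p k}"

lemma empirical_measure_eq_distr:
  fixes p :: "'l::finite \<Rightarrow> 'a::topological_space"
  assumes "range p \<subseteq> X"
  shows "empirical_measure X p =
    distr (uniform_count_measure UNIV) (restrict_space borel X) p" (is "_ = ?D")
proof -
  have meas: "p \<in> measurable (uniform_count_measure UNIV) (restrict_space borel X)"
    using assms by (auto simp: measurable_def space_restrict_space space_uniform_count_measure
        sets_uniform_count_measure)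
  have sp: "space ?D = X" and se: "sets ?D = sets (restrict_space borel X)"
    by (simp_all add: space_restrict_space)
  have "measure_of X (sets (restrict_space borel X)) (emeasure ?D) = empirical_measure X p"
    unfolding empirical_measure_def
  proof (rule measure_of_eq)
    show "sets (restrict_space borel X) \<subseteq> Pow X"
      using sets.space_closed[of "restrict_space borel X"] by (simp add: space_restrict_space)
    fix B assume "B \<in> sigma_sets X (sets (restrict_space borel X))"
    then have B: "B \<in> sets (restrict_space borel X)"
      using sets.sigma_sets_eq[of "restrict_space borel X"] by (simp add: space_restrict_space)
    have "emeasure ?D B = of_nat (card (p -` B)) / of_nat CARD('l)"
      using B meas by (simp add: emeasure_distr emeasure_uniform_count_measure
          space_uniform_count_measure divide_ennreal ennreal_of_nat_eq_real_of_nat)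
    also have "of_nat (card (p -` B)) = (\<Sum>i\<in>UNIV. indicator B (p i) :: ennreal)"
      by (simp add: indicator_def vimage_def)
    finally show "emeasure ?D B =
        (\<Sum>i\<in>UNIV. emeasure (return (restrict_space borel X) (p i)) B) / of_nat CARD('l)"
      using B by simp
  qed
  then show ?thesis
    using measure_of_of_measure[of ?D] sp se by simp
qed

lemma prob_space_empirical_measure:
  fixes p :: "'l::finite \<Rightarrow> 'a::topological_space"
  assumes "range p \<subseteq> X"
  shows "prob_space (empirical_measure X p)"
  unfolding empirical_measure_eq_distr[OF assms]
proof (rule prob_space.prob_space_distr)
  show "prob_space (uniform_count_measure (UNIV :: 'l set))"
    by (rule prob_space_uniform_count_measure) auto
qed (use assms in \<open>auto simp: measurable_def space_restrict_space space_uniform_count_measure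
      sets_uniform_count_measure\<close>)

lemma integral_empirical_measure:
  fixes p :: "'l::finite \<Rightarrow> 'a::topological_space"
    and Y :: "'a \<Rightarrow> 'b::{banach, second_countable_topology}"
  assumes "range p \<subseteq> X" and "Y \<in> borel_measurable (restrict_space borel X)"
  shows "(LINT x|empirical_measure X p. Y x) = (1 / real CARD('l)) *\<^sub>R (\<Sum>i\<in>UNIV. Y (p i))"
proof -
  have meas: "p \<in> measurable (uniform_count_measure UNIV) (restrict_space borel X)"
    using assms by (auto simp: measurable_def space_restrict_space space_uniform_count_measure
        sets_uniform_count_measure)
  show ?thesis
    unfolding empirical_measure_eq_distr[OF assms(1)] integral_distr[OF meas assms(2)]
    unfolding uniform_count_measure_def
    by (subst lebesgue_integral_point_measure_finite) (auto simp: scaleR_sum_right)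
qed

end

theory Submission
  imports Defs
begin

text \<open>
  The residual obeys the linear recursion \<open>R (t + 1) = A R t + D t\<close> pointwise: one more step of the
  lifted system propagates the old residual by \<open>A\<close> and adds the one-step error committed along the
  true trajectory (lemma \<open>residual_Suc\<close>). The hypothesis \<open>\<nu> (k + 1) = A \<nu> k\<close> says exactly that \<open>D k\<close>
  has empirical mean zero (lemma \<open>sum_local_error_eq_0\<close>). Since \<open>R 0 = 0\<close>, the recursion then makes \<open>R s\<close> centred for all
  \<open>s \<le> N\<close> (lemma \<open>sum_residual_eq_0\<close>).

  For centred vectors the variance is the plain second moment \<open>E (Y Y\<^sup>T)\<close>. Expanding
  \<open>(A R + D) (A R + D)\<^sup>T\<close> into its four terms and taking expectations gives the claimed identity; this
  holds over any measure for which the moments exist (lemma \<open>variance_matrix_linear_update\<close>).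
  Under the empirical measure every Borel function on \<open>X\<close> has moments, because its expectation is a
  finite average; measurability of \<open>R t\<close> and \<open>D t\<close> follows from continuity of \<open>f\<close> and \<open>\<psi>\<close>.
\<close>

section \<open>Outer products and matrix multiplication\<close>

lemma outer_product_add_left: "outer_product (u + v) w = outer_product u w + outer_product v w"
  by (simp add: outer_product_def vec_eq_iff algebra_simps)

lemma outer_product_add_right: "outer_product u (v + w) = outer_product u v + outer_product u w"
  by (simp add: outer_product_def vec_eq_iff algebra_simps)

lemma outer_product_matrix_left: "outer_product (A *v v) w = A ** outer_product v w"
  by (simp add: outer_product_def matrix_matrix_mult_def matrix_vector_mult_def vec_eq_iff
      sum_distrib_right mult.assoc)

lemma transpose_outer_product: "transpose (outer_product v w) = outer_product w v"
  by (simp add: outer_product_def transpose_def vec_eq_iff)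

lemma outer_product_matrix_right: "outer_product v (A *v w) = outer_product v w ** transpose A"
  by (metis outer_product_matrix_left transpose_outer_product matrix_transpose_mul
      transpose_transpose)

lemma continuous_on_outer_product:
  assumes "continuous_on S Y" and "continuous_on S Z"
  shows "continuous_on S (\<lambda>x. outer_product (Y x) (Z x))"
  unfolding outer_product_def using assms by (intro continuous_intros)

lemma bounded_linear_matrix_mult_left: "bounded_linear (\<lambda>B :: real ^ 'k ^ 'm. A ** B)"
  for A :: "real ^ 'm::finite ^ 'n::finite"
  by (intro linear_conv_bounded_linear[THEN iffD1] linearI)
    (simp_all add: matrix_matrix_mult_def vec_eq_iff algebra_simps sum.distrib sum_distrib_left)

lemma bounded_linear_matrix_mult_right: "bounded_linear (\<lambda>B :: real ^ 'm ^ 'k. B ** C)"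
  for C :: "real ^ 'n ^ 'm::finite"
  by (intro linear_conv_bounded_linear[THEN iffD1] linearI)
    (simp_all add: matrix_matrix_mult_def vec_eq_iff algebra_simps sum.distrib sum_distrib_left)

lemma bounded_linear_transpose: "bounded_linear (transpose :: real ^ 'n ^ 'm \<Rightarrow> real ^ 'm ^ 'n)"
  by (intro linear_conv_bounded_linear[THEN iffD1] linearI) (simp_all add: transpose_def vec_eq_iff)

section \<open>Variance of a centred linear update\<close>

text \<open>
  All means vanish, so the variances are second moments, and the right-hand side is the
  expectation of the expanded product \<open>(A Y + Z) (A Y + Z)\<^sup>T\<close>. The two mixed terms are
  transposes of each other.
\<close>

lemma variance_matrix_linear_update:
  fixes M :: "'a measure" and Y Z :: "'a \<Rightarrow> real ^ 'm::finite" and A :: "real ^ 'm ^ 'm"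
  defines "\<Gamma> \<equiv> (LINT x|M. outer_product (Y x) (Z x))"
  assumes "integrable M Y" and "integrable M Z"
    and "(LINT x|M. Y x) = 0" and "(LINT x|M. Z x) = 0"
    and YY: "integrable M (\<lambda>x. outer_product (Y x) (Y x))"
    and YZ: "integrable M (\<lambda>x. outer_product (Y x) (Z x))"
    and ZZ: "integrable M (\<lambda>x. outer_product (Z x) (Z x))"
  shows "variance_matrix M (\<lambda>x. A *v Y x + Z x) =
    A ** variance_matrix M Y ** transpose A + A ** \<Gamma> + transpose \<Gamma> ** transpose A
      + variance_matrix M Z"
proof -
  note left = bounded_linear_matrix_mult_left[of A]
  note right = bounded_linear_matrix_mult_right[of "transpose A"]
  note tr = bounded_linear_transpose
  have "integrable M (\<lambda>x. A *v Y x)" and "(LINT x|M. A *v Y x) = A *v (LINT x|M. Y x)"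
    using integrable_bounded_linear[OF matrix_vector_mul_bounded_linear]
      integral_bounded_linear[OF matrix_vector_mul_bounded_linear] assms(2)
    by auto
  then have mean: "(LINT x|M. A *v Y x + Z x) = 0"
    using assms by simp
  have expand: "outer_product (A *v Y x + Z x) (A *v Y x + Z x) =
      A ** outer_product (Y x) (Y x) ** transpose A + A ** outer_product (Y x) (Z x)
        + transpose (outer_product (Y x) (Z x)) ** transpose A + outer_product (Z x) (Z x)" for x
    by (simp add: outer_product_add_left outer_product_add_right outer_product_matrix_left
        outer_product_matrix_right transpose_outer_product matrix_mul_assoc
        linear_add[OF bounded_linear.linear[OF right]])
  note ints = integrable_bounded_linear[OF right integrable_bounded_linear[OF left YY]]
    integrable_bounded_linear[OF left YZ]
    integrable_bounded_linear[OF right integrable_bounded_linear[OF tr YZ]]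
  show ?thesis
    unfolding variance_matrix_def mean assms(4,5) diff_zero expand \<Gamma>_def
    by (simp add: ints YY YZ ZZ integral_bounded_linear[OF left] integral_bounded_linear[OF tr]
        integral_bounded_linear[OF right] integrable_bounded_linear[OF left]
        integrable_bounded_linear[OF tr])
qed

section \<open>Recursion and mean of the residual\<close>

lemma residual_Suc:
  "residual f \<psi> A (Suc t) x = A *v residual f \<psi> A t x + local_error f \<psi> A t x"
  by (simp add: residual_def local_error_def matrix_vector_mult_diff_distrib)

lemma sum_local_error_eq_0:
  fixes p :: "'l::finite \<Rightarrow> 'a"
  assumes "sample_mean f \<psi> p (Suc k) = A *v sample_mean f \<psi> p k"
  shows "(\<Sum>i\<in>UNIV. local_error f \<psi> A k (p i)) = 0"
proof -
  have "(1 / real CARD('l)) *\<^sub>R (\<Sum>i\<in>UNIV. local_error f \<psi> A k (p i)) =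
      sample_mean f \<psi> p (Suc k) - A *v sample_mean f \<psi> p k"
    by (simp add: local_error_def sample_mean_def sum_subtractf scaleR_diff_right
        matrix_vector_mult_scaleR vec.sum)
  then show ?thesis
    using assms by simp
qed

lemma sum_residual_eq_0:
  fixes p :: "'l::finite \<Rightarrow> 'a"
  assumes "\<And>k. k < s \<Longrightarrow> sample_mean f \<psi> p (Suc k) = A *v sample_mean f \<psi> p k"
  shows "(\<Sum>i\<in>UNIV. residual f \<psi> A s (p i)) = 0"
  using assms
proof (induction s)
  case 0
  then show ?case by (simp add: residual_def)
next
  case (Suc s)
  then show ?case
    by (simp add: residual_Suc sum.distrib sum_local_error_eq_0 flip: vec.sum)
qed

section \<open>Continuity and integrability\<close>

lemma trajectory_in:
  assumes "\<And>x. x \<in> X \<Longrightarrow> f x \<in> X" and "x \<in> X"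
  shows "trajectory f x t \<in> X"
  by (induction t) (auto simp: assms)

lemma continuous_on_trajectory:
  assumes "continuous_on X f" and "\<And>x. x \<in> X \<Longrightarrow> f x \<in> X"
  shows "continuous_on X (\<lambda>x. trajectory f x t)"
proof (induction t)
  case (Suc t)
  then show ?case
    using continuous_on_compose2[OF assms(1), of X "\<lambda>x. trajectory f x t"]
      trajectory_in[of X f] assms(2)
    by auto
qed simp

lemma continuous_on_lift_trajectory:
  assumes "continuous_on X f" and inv: "\<And>x. x \<in> X \<Longrightarrow> f x \<in> X"
    and "\<And>i. continuous_on X (\<psi> i)"
  shows "continuous_on X (\<lambda>x. lift \<psi> (trajectory f x t))"
proof -
  have "continuous_on X (\<lambda>x. \<psi> i (trajectory f x t))" for i
    by (rule continuous_on_compose2[OF assms(3) continuous_on_trajectory[OF assms(1) inv]])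
      (auto intro: trajectory_in[OF inv])
  then show ?thesis
    unfolding lift_def by (intro continuous_intros)
qed

lemma continuous_on_local_error:
  assumes "continuous_on X f" and "\<And>x. x \<in> X \<Longrightarrow> f x \<in> X" and "\<And>i. continuous_on X (\<psi> i)"
  shows "continuous_on X (local_error f \<psi> A t)"
  unfolding local_error_def
  by (intro continuous_on_diff continuous_on_lift_trajectory assms
      bounded_linear.continuous_on[OF matrix_vector_mul_bounded_linear])

lemma continuous_on_residual:
  assumes "continuous_on X f" and "\<And>x. x \<in> X \<Longrightarrow> f x \<in> X" and "\<And>i. continuous_on X (\<psi> i)"
  shows "continuous_on X (residual f \<psi> A t)"
proof (induction t)
  case 0
  then show ?case by (simp add: residual_def)
next
  case (Suc t)
  then show ?case
    unfolding residual_Suc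
    by (intro continuous_on_add continuous_on_local_error assms
        bounded_linear.continuous_on[OF matrix_vector_mul_bounded_linear])
qed

text \<open>
  The empirical measure is the image of the uniform measure on a finite index set, where every
  function is integrable.
\<close>

lemma integrable_empirical_measure:
  fixes p :: "'l::finite \<Rightarrow> 'a::topological_space"
    and Y :: "'a \<Rightarrow> 'b::{banach, second_countable_topology}"
  assumes "range p \<subseteq> X" and "Y \<in> borel_measurable (restrict_space borel X)"
  shows "integrable (empirical_measure X p) Y"
proof -
  have meas: "p \<in> measurable (uniform_count_measure UNIV) (restrict_space borel X)"
    using assms(1) by (auto simp: measurable_def space_restrict_space space_uniform_count_measure
        sets_uniform_count_measure)
  show ?thesis
    unfolding empirical_measure_eq_distr[OF assms(1)] integrable_distr_eq[OF meas assms(2)]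
    unfolding uniform_count_measure_def
    by (rule integrable_point_measure_finite) simp
qed

section \<open>Propagation of the residual covariance\<close>

theorem proposition4:
  fixes f :: "real ^ 'n \<Rightarrow> real ^ 'n"
    and X :: "(real ^ 'n) set"
    and \<psi> :: "'m::finite \<Rightarrow> real ^ 'n \<Rightarrow> real"
    and p :: "'l::finite \<Rightarrow> real ^ 'n"
    and N t :: nat
    and A :: "real ^ 'm ^ 'm"
    and P :: "(real ^ 'n) measure"
    and \<Sigma> \<Omega> \<Gamma> :: "nat \<Rightarrow> real ^ 'm ^ 'm"
  assumes "continuous_on UNIV f"
    and "X \<noteq> {}" and "compact X" and "\<And>x. x \<in> X \<Longrightarrow> f x \<in> X"
    and "\<And>i. square_integrable_on (\<psi> i) X"
    and "\<And>i. continuous_on X (\<psi> i)"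
    and "lin_indep_functions_on X \<psi>"
    and "inj_on (lift \<psi>) X"
    and "\<And>j. p j \<in> X"
    and "CARD('l) \<ge> CARD('m)"
    and "rank (data_matrix \<psi> p) = CARD('m)"
    and "N \<ge> 1"
    and "A \<in> mean_exact_matrices f \<psi> p (N - 1)"
    and "P = empirical_measure X p"
    and "\<And>s. \<Sigma> s = variance_matrix P (residual f \<psi> A s)"
    and "\<And>s. \<Omega> s = variance_matrix P (local_error f \<psi> A s)"
    and "\<And>s. \<Gamma> s = (LINT x|P. outer_product (residual f \<psi> A s x) (local_error f \<psi> A s x))"
    and "t \<in> {1..N - 1}"
  shows "\<Sigma> (t + 1) = A ** \<Sigma> t ** transpose A + A ** \<Gamma> t + transpose (\<Gamma> t) ** transpose A + \<Omega> t"
proof -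
  have cont_f: "continuous_on X f"
    using assms(1) continuous_on_subset by blast
  have range: "range p \<subseteq> X"
    using assms(9) by auto
  note contR = continuous_on_residual[OF cont_f assms(4,6), where A = A and t = t]
  note contD = continuous_on_local_error[OF cont_f assms(4,6), where A = A and t = t]
  have int: "integrable P Y" if "continuous_on X Y"
    for Y :: "real ^ 'n \<Rightarrow> 'c::{banach, second_countable_topology}"
    unfolding assms(14)
    by (rule integrable_empirical_measure[OF range borel_measurable_continuous_on_restrict[OF that]])
  have mean: "(LINT x|P. Y x) = (1 / real CARD('l)) *\<^sub>R (\<Sum>i\<in>UNIV. Y (p i))"
    if "continuous_on X Y" for Y :: "real ^ 'n \<Rightarrow> real ^ 'm"
    unfolding assms(14)
    by (rule integral_empirical_measure[OF range borel_measurable_continuous_on_restrict[OF that]])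
  (* k = t is still covered: t <= N - 1, the last index in the hypothesis on A. *)
  have exact: "sample_mean f \<psi> p (Suc k) = A *v sample_mean f \<psi> p k" if "k \<le> t" for k
    using assms(13,18) that by (simp add: mean_exact_matrices_def)
  have meanR: "(LINT x|P. residual f \<psi> A t x) = 0"
    using mean[OF contR] sum_residual_eq_0[of t f \<psi> p A] exact by simp
  have meanD: "(LINT x|P. local_error f \<psi> A t x) = 0"
    using mean[OF contD] sum_local_error_eq_0[of f \<psi> p t A] exact by simp
  have "\<Sigma> (t + 1) = variance_matrix P (\<lambda>x. A *v residual f \<psi> A t x + local_error f \<psi> A t x)"
    unfolding assms(15) by (simp add: residual_Suc[abs_def])
  also have "\<dots> = A ** \<Sigma> t ** transpose A + A ** \<Gamma> t + transpose (\<Gamma> t) ** transpose A + \<Omega> t"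
    unfolding assms(15-17)
    by (intro variance_matrix_linear_update int contR contD continuous_on_outer_product meanR meanD)
  finally show ?thesis .
qed

end
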